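(* Let $H$ be a Hilbert space and let $E_{1}$ and $E_{2}$ be non-commuting elements of $L(H)$. Then there exists a pure state, i.e. a unit vector $\Psi \in H$, such that $$\langle \Psi ,E_{1}\Psi \rangle + \langle \Psi ,E_{2}\Psi \rangle - \langle \Psi ,(E_{1}\wedge E_{2})\Psi \rangle >1.$$
   Context: $L(H)$ denotes the lattice of closed subspaces of the Hilbert space $H$. A closed subspace and the orthogonal projector onto it are denoted by the same letter. For $E_1,E_2\in L(H)$, $E_{1}\wedge E_{2}$ is the intersection $E_1\cap E_2$ (and, in the expression $(E_1\wedge E_2)\Psi$, the orthogonal projector onto this intersection). Two elements $E_1,E_2$ of $L(H)$ are non-commuting if the corresponding orthogonal projectors do not commute as operators. *)

theory Defs
  imports "HOL-Analysis.Analysis" "HOL-Library.Complex_Order"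
begin

(* Complex Hilbert spaces. The norm, metric, topology and real scalar multiplication are inherited
   from the underlying real Hilbert space, whose real inner product is the real part of cinner
   (so cinner is positive definite and induces the norm). As usual in physics, cinner is linear in
   its second and antilinear in its first argument. Complex_Order is imported so that inequalities
   between expectation values can be stated directly: a < b on complex numbers means
   Re a < Re b and Im a = Im b. *)

class chilbert_space = real_inner + complete_space +
  fixes scaleC :: "complex \<Rightarrow> 'a \<Rightarrow> 'a" (infixr "*\<^sub>C" 75)
    and cinner :: "'a \<Rightarrow> 'a \<Rightarrow> complex"
  assumes scaleC_add_right: "a *\<^sub>C (x + y) = a *\<^sub>C x + a *\<^sub>C y"
    and scaleC_add_left: "(a + b) *\<^sub>C x = a *\<^sub>C x + b *\<^sub>C x"
    and scaleC_scaleC: "a *\<^sub>C (b *\<^sub>C x) = (a * b) *\<^sub>C x"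
    and scaleC_one: "1 *\<^sub>C x = x"
    and scaleC_of_real: "complex_of_real r *\<^sub>C x = r *\<^sub>R x"
    and cinner_commute: "cinner x y = cnj (cinner y x)"
    and cinner_add_right: "cinner x (y + z) = cinner x y + cinner x z"
    and cinner_scaleC_right: "cinner x (a *\<^sub>C y) = a * cinner x y"
    and Re_cinner: "Re (cinner x y) = inner x y"

global_interpretation complex_vector: vector_space "scaleC :: complex \<Rightarrow> 'a \<Rightarrow> 'a::chilbert_space"
  defines csubspace = complex_vector.subspace
  by standard (simp_all add: scaleC_add_right scaleC_add_left scaleC_scaleC scaleC_one)

definition closed_subspaces :: "'a::chilbert_space set set" where
  "closed_subspaces = {E. csubspace E \<and> closed E}"

definition projector :: "'a::chilbert_space set \<Rightarrow> 'a \<Rightarrow> 'a" where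
  "projector E x = (THE y. y \<in> E \<and> (\<forall>z\<in>E. cinner z (x - y) = 0))"

(* The projection theorem: projector is well-defined on closed subspaces. *)
lemma ex1_projection:
  fixes E :: "'a::chilbert_space set"
  assumes "E \<in> closed_subspaces"
  shows "\<exists>!y. y \<in> E \<and> (\<forall>z\<in>E. cinner z (x - y) = 0)"
proof -
  have sub: "csubspace E" and cl: "closed E"
    using assms by (auto simp: closed_subspaces_def)
  have addE: "y + z \<in> E" if "y \<in> E" "z \<in> E" for y z
    using complex_vector.subspace_add[OF sub] that by blast
  have diffE: "y - z \<in> E" if "y \<in> E" "z \<in> E" for y z
    using complex_vector.subspace_diff[OF sub] that by blast
  have scE: "a *\<^sub>C y \<in> E" if "y \<in> E" for a y
    using complex_vector.subspace_scale[OF sub] that by blast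
  have scRE: "r *\<^sub>R y \<in> E" if "y \<in> E" for r y
    using scE[OF that, of "complex_of_real r"] by (simp add: scaleC_of_real)
  have ne: "E \<noteq> {}"
    using complex_vector.subspace_0[OF sub] by blast
  define d where "d = infdist x E"
  have d0: "d \<ge> 0" by (simp add: d_def infdist_nonneg)
  have dle: "d \<le> norm (x - y)" if "y \<in> E" for y
    using infdist_le[OF that, of x] by (simp add: d_def dist_norm)
  define e where "e n = inverse (real (Suc n))" for n
  have e0: "e n > 0" for n by (simp add: e_def)
  have "\<exists>y\<in>E. norm (x - y) < d + e n" for n
  proof (rule ccontr)
    assume "\<not> ?thesis"
    then have "d + e n \<le> (INF y\<in>E. dist x y)"
      using ne by (intro cINF_greatest) (auto simp: dist_norm not_less)
    then show False using e0[of n] ne by (simp add: d_def infdist_def)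
  qed
  then obtain y where yE: "y n \<in> E" and yd: "norm (x - y n) < d + e n" for n
    by metis
  have e_tendsto: "e \<longlonglongrightarrow> 0"
    unfolding e_def by (rule LIMSEQ_inverse_real_of_nat)
  have bound: "(norm (y m - y n))\<^sup>2 \<le> 8 * d * e N + 4 * (e N)\<^sup>2" if "m \<ge> N" "n \<ge> N" for m n N
  proof -
    have sq: "(norm (x - y k))\<^sup>2 \<le> (d + e N)\<^sup>2" if "k \<ge> N" for k
    proof (rule power_mono)
      have "e k \<le> e N" using that by (simp add: e_def)
      then show "norm (x - y k) \<le> d + e N" using yd[of k] by linarith
    qed simp
    have mid: "d\<^sup>2 \<le> (norm (x - (1/2) *\<^sub>R (y m + y n)))\<^sup>2"
      using dle[OF scRE[OF addE[OF yE yE]]] d0 by (intro power_mono) auto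
    have "(norm (y m - y n))\<^sup>2 = 2 * (norm (x - y m))\<^sup>2 + 2 * (norm (x - y n))\<^sup>2
        - 4 * (norm (x - (1/2) *\<^sub>R (y m + y n)))\<^sup>2"
      by (simp add: power2_norm_eq_inner inner_simps inner_commute field_simps)
    also have "\<dots> \<le> 4 * (d + e N)\<^sup>2 - 4 * d\<^sup>2"
      using sq[OF that(1)] sq[OF that(2)] mid by linarith
    also have "\<dots> = 8 * d * e N + 4 * (e N)\<^sup>2"
      by (simp add: power2_eq_square algebra_simps)
    finally show ?thesis .
  qed
  have "Cauchy y"
  proof (rule metric_CauchyI)
    fix r :: real assume "r > 0"
    have "(\<lambda>N. 8 * d * e N + 4 * (e N)\<^sup>2) \<longlonglongrightarrow> 8 * d * 0 + 4 * 0\<^sup>2"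
      by (intro tendsto_intros e_tendsto)
    then have "\<forall>\<^sub>F N in sequentially. 8 * d * e N + 4 * (e N)\<^sup>2 < r\<^sup>2"
      using \<open>r > 0\<close> by (intro order_tendstoD(2)) auto
    then obtain N where "8 * d * e N + 4 * (e N)\<^sup>2 < r\<^sup>2"
      by (auto simp: eventually_sequentially)
    then have "dist (y m) (y n) < r" if "m \<ge> N" "n \<ge> N" for m n
      using bound[OF that] \<open>r > 0\<close> by (simp add: dist_norm power2_less_imp_less)
    then show "\<exists>N. \<forall>m\<ge>N. \<forall>n\<ge>N. dist (y m) (y n) < r" by blast
  qed
  then obtain p where lim: "y \<longlonglongrightarrow> p"
    using Cauchy_convergent convergent_def by blast
  have pE: "p \<in> E"
    using closed_sequentially[OF cl] yE lim by blast
  have "norm (x - p) \<le> d + 0"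
    by (rule tendsto_le[OF _ tendsto_add[OF tendsto_const e_tendsto] tendsto_norm[OF tendsto_diff[OF tendsto_const lim]]])
      (auto intro!: always_eventually less_imp_le yd)
  then have min: "norm (x - p) \<le> norm (x - z)" if "z \<in> E" for z
    using dle[OF that] by simp
  have orth: "inner z (x - p) = 0" if "z \<in> E" for z
  proof (cases "z = 0")
    case False
    define t where "t = inner z (x - p) / inner z z"
    have "norm (x - p) \<le> norm (x - p - t *\<^sub>R z)"
      using min[OF addE[OF pE scRE[OF that, of t]]] by (simp add: algebra_simps)
    then have "(norm (x - p))\<^sup>2 \<le> (norm (x - p - t *\<^sub>R z))\<^sup>2"
      by (intro power_mono) auto
    also have "\<dots> = (norm (x - p))\<^sup>2 - 2 * t * inner z (x - p) + t\<^sup>2 * inner z z"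
      unfolding power2_norm_eq_inner
      by (simp add: inner_diff_left inner_diff_right inner_commute power2_eq_square algebra_simps)
    also have "\<dots> = (norm (x - p))\<^sup>2 - (inner z (x - p))\<^sup>2 / inner z z"
      using False by (simp add: t_def power2_eq_square)
    finally have "(inner z (x - p))\<^sup>2 / inner z z \<le> 0" by simp
    moreover have "inner z z > 0" using False by simp
    ultimately show ?thesis by (simp add: divide_le_0_iff)
  qed simp
  have corth: "cinner z (x - p) = 0" if "z \<in> E" for z
  proof (rule complex_eqI)
    show "Re (cinner z (x - p)) = Re 0" using orth[OF that] by (simp add: Re_cinner)
    have "cinner (\<i> *\<^sub>C z) (x - p) = - \<i> * cinner z (x - p)"
      by (subst (1 2) cinner_commute) (simp add: cinner_scaleC_right)
    then have "Re (- \<i> * cinner z (x - p)) = 0"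
      using orth[OF scE[OF that, of \<i>]] by (metis Re_cinner)
    then show "Im (cinner z (x - p)) = Im 0" by simp
  qed
  show ?thesis
  proof (rule ex1I[of _ p])
    show "p \<in> E \<and> (\<forall>z\<in>E. cinner z (x - p) = 0)" using pE corth by blast
    fix q assume q: "q \<in> E \<and> (\<forall>z\<in>E. cinner z (x - q) = 0)"
    have "q - p \<in> E" using q pE diffE by blast
    then have "inner (q - p) (x - q) = 0" "inner (q - p) (x - p) = 0"
      using q corth by (metis Re_cinner zero_complex.sel(1))+
    then have "inner (q - p) (q - p) = 0" by (simp add: inner_diff_right)
    then show "q = p" by simp
  qed
qed

end

(* If x lies in E1, then the expression at x equals |x|^2 + |E2 x|^2 - |(E1 /\ E2) x|^2. Since
   (E1 /\ E2) x = (E1 /\ E2) (E2 x), it exceeds |x|^2 as soon as E2 x and (E1 /\ E2) x differ.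
   If no such x exists, neither in E1 nor, symmetrically, in E2, then
   E2 E1 = E1 /\ E2 = E1 E2, and the projectors commute. *)
theory Submission
  imports Defs
begin

lemma projector_props:
  assumes "E \<in> closed_subspaces"
  shows projector_in: "projector E x \<in> E"
    and projector_orthogonal: "z \<in> E \<Longrightarrow> cinner z (x - projector E x) = 0"
  using theI'[OF ex1_projection[OF assms, of x]] unfolding projector_def by blast+

text \<open>The uniqueness half of the projection theorem; the values of projectors below are found
  by exhibiting a candidate and checking orthogonality.\<close>

lemma projector_eqI:
  assumes "E \<in> closed_subspaces" "y \<in> E" "\<And>z. z \<in> E \<Longrightarrow> cinner z (x - y) = 0"
  shows "projector E x = y"
  using ex1_projection[OF assms(1), of x] projector_in[OF assms(1), of x]
    projector_orthogonal[OF assms(1), of _ x] assms(2,3) by metis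

lemma closed_subspaces_Int:
  assumes "E \<in> closed_subspaces" "F \<in> closed_subspaces"
  shows "E \<inter> F \<in> closed_subspaces"
  using assms by (simp add: closed_subspaces_def closed_Int complex_vector.subspace_inter)

lemma projector_id:
  assumes "E \<in> closed_subspaces" "x \<in> E"
  shows "projector E x = x"
proof (rule projector_eqI[OF assms])
  show "cinner z (x - x) = 0" for z
    \<comment> \<open>Additivity at \<open>0 + 0\<close> forces
      \<open>cinner z 0 = 0\<close>.\<close>
    using cinner_add_right[of z 0 0] by simp
qed

lemma projector_scaleR:
  assumes "E \<in> closed_subspaces"
  shows "projector E (r *\<^sub>R x) = r *\<^sub>R projector E x"
proof (rule projector_eqI[OF assms])
  have "csubspace E"
    using assms by (simp add: closed_subspaces_def)
  then show "r *\<^sub>R projector E x \<in> E"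
    using projector_in[OF assms] complex_vector.subspace_scale scaleC_of_real by metis
  fix z assume "z \<in> E"
  then show "cinner z (r *\<^sub>R x - r *\<^sub>R projector E x) = 0"
    using projector_orthogonal[OF assms, of z x] cinner_scaleC_right[of z "complex_of_real r"]
    by (simp add: scaleC_of_real flip: scaleR_diff_right)
qed

text \<open>The error splits into \<open>x - projector E x\<close>, orthogonal to \<open>E\<close>
  and hence to \<open>F\<close>, and the error of projecting \<open>projector E x\<close> onto
  \<open>F\<close>.\<close>

lemma projector_projector:
  assumes E: "E \<in> closed_subspaces" and F: "F \<in> closed_subspaces" and "F \<subseteq> E"
  shows "projector F (projector E x) = projector F x"
proof (rule sym, rule projector_eqI[OF F projector_in[OF F]])
  fix z assume "z \<in> F"
  moreover have "x - projector F (projector E x) =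
      (x - projector E x) + (projector E x - projector F (projector E x))"
    by simp
  ultimately show "cinner z (x - projector F (projector E x)) = 0"
    using projector_orthogonal[OF E, of z x] projector_orthogonal[OF F, of z "projector E x"]
      \<open>F \<subseteq> E\<close> by (simp only: cinner_add_right) auto
qed

lemma cinner_self: "cinner x x = complex_of_real ((norm x)\<^sup>2)"
proof (rule complex_eqI)
  show "Re (cinner x x) = Re (complex_of_real ((norm x)\<^sup>2))"
    by (simp add: Re_cinner power2_norm_eq_inner)
  show "Im (cinner x x) = Im (complex_of_real ((norm x)\<^sup>2))"
    using arg_cong[OF cinner_commute[of x x], of Im] by simp
qed

text \<open>Split \<open>x\<close> into its projection and an orthogonal remainder. The value is
  real, so expectation values are comparable in the order on complex numbers.\<close>

lemma cinner_projector:
  assumes "E \<in> closed_subspaces"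
  shows "cinner x (projector E x) = complex_of_real ((norm (projector E x))\<^sup>2)"
proof -
  let ?p = "projector E x"
  have "cinner ?p x = cinner ?p ?p + cinner ?p (x - ?p)"
    by (simp flip: cinner_add_right)
  then have "cinner ?p x = complex_of_real ((norm ?p)\<^sup>2)"
    using projector_orthogonal[OF assms projector_in[OF assms]] by (simp add: cinner_self)
  then show ?thesis
    using cinner_commute[of x ?p] by simp
qed

text \<open>Pythagoras, with a nonzero remainder \<open>x - projector E x\<close>.\<close>

lemma norm_projector_less:
  assumes "E \<in> closed_subspaces" "projector E x \<noteq> x"
  shows "norm (projector E x) < norm x"
proof -
  let ?p = "projector E x"
  have "inner ?p (x - ?p) = 0"
    using projector_orthogonal[OF assms(1) projector_in[OF assms(1)]]
    by (simp flip: Re_cinner)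
  then have "(norm x)\<^sup>2 = (norm ?p)\<^sup>2 + (norm (x - ?p))\<^sup>2"
    by (simp add: power2_norm_eq_inner inner_diff_left inner_diff_right inner_commute)
  then have "(norm ?p)\<^sup>2 < (norm x)\<^sup>2"
    using assms(2) by simp
  then show ?thesis
    by (simp add: power2_less_imp_less)
qed

lemma violating_state_in_subspace:
  fixes E F :: "'a::chilbert_space set"
  assumes E: "E \<in> closed_subspaces" and F: "F \<in> closed_subspaces"
    and "x \<in> E" and neq: "projector F x \<noteq> projector (E \<inter> F) x"
  shows "\<exists>\<Psi>::'a. norm \<Psi> = 1 \<and>
    cinner \<Psi> (projector E \<Psi>) + cinner \<Psi> (projector F \<Psi>)
      - cinner \<Psi> (projector (E \<inter> F) \<Psi>) > 1"
proof -
  note G = closed_subspaces_Int[OF E F]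
  \<comment> \<open>Both projections of the zero vector vanish, which \<open>neq\<close>
    excludes.\<close>
  have "x \<noteq> 0"
    using neq projector_scaleR[OF F, of 0 0] projector_scaleR[OF G, of 0 0] by auto
  define \<Psi> where "\<Psi> = inverse (norm x) *\<^sub>R x"
  have unit: "norm \<Psi> = 1"
    using \<open>x \<noteq> 0\<close> by (simp add: \<Psi>_def)
  have "projector E \<Psi> = \<Psi>"
    by (simp add: \<Psi>_def projector_scaleR[OF E] projector_id[OF E \<open>x \<in> E\<close>])
  then have one: "cinner \<Psi> (projector E \<Psi>) = 1"
    by (simp add: cinner_self unit)
  have proj: "projector (E \<inter> F) (projector F \<Psi>) = projector (E \<inter> F) \<Psi>"
    by (rule projector_projector[OF F G]) simp
  \<comment> \<open>Projectors are homogeneous, so \<open>neq\<close> survives the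
    normalization.\<close>
  have "projector F \<Psi> \<noteq> projector (E \<inter> F) \<Psi>"
    using neq \<open>x \<noteq> 0\<close> by (simp add: \<Psi>_def projector_scaleR[OF F] projector_scaleR[OF G])
  \<comment> \<open>By \<open>proj\<close>, the left vector is the projection of
    \<open>projector F \<Psi>\<close> onto the intersection, and it differs from that
    vector.\<close>
  then have "norm (projector (E \<inter> F) \<Psi>) < norm (projector F \<Psi>)"
    using norm_projector_less[OF G, of "projector F \<Psi>"] by (simp add: proj)
  then have "(norm (projector (E \<inter> F) \<Psi>))\<^sup>2 < (norm (projector F \<Psi>))\<^sup>2"
    by (simp add: power_strict_mono)
  then have "cinner \<Psi> (projector E \<Psi>) + cinner \<Psi> (projector F \<Psi>)
      - cinner \<Psi> (projector (E \<inter> F) \<Psi>) > 1"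
    unfolding one cinner_projector[OF F] cinner_projector[OF G] less_complex_def by simp
  with unit show ?thesis by blast
qed

theorem theorem2:
  fixes E1 E2 :: "'a::chilbert_space set"
  assumes "E1 \<in> closed_subspaces" and "E2 \<in> closed_subspaces"
    and "projector E1 \<circ> projector E2 \<noteq> projector E2 \<circ> projector E1"
  shows "\<exists>\<Psi>::'a. norm \<Psi> = 1 \<and>
    cinner \<Psi> (projector E1 \<Psi>) + cinner \<Psi> (projector E2 \<Psi>)
      - cinner \<Psi> (projector (E1 \<inter> E2) \<Psi>) > 1"
proof -
  note G = closed_subspaces_Int[OF assms(1,2)]
  obtain y where "projector E1 (projector E2 y) \<noteq> projector E2 (projector E1 y)"
    using assms(3) by (auto simp: fun_eq_iff)
  \<comment> \<open>Both sides are the projection of \<open>y\<close> onto the intersection. If both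
    products at \<open>y\<close> took this common value, they would agree; so one of them differs
    from it.\<close>
  moreover have "projector (E1 \<inter> E2) (projector E1 y) = projector (E1 \<inter> E2) (projector E2 y)"
    using projector_projector[OF assms(1) G] projector_projector[OF assms(2) G] by simp
  ultimately consider
      "projector E2 (projector E1 y) \<noteq> projector (E1 \<inter> E2) (projector E1 y)"
    | "projector E1 (projector E2 y) \<noteq> projector (E2 \<inter> E1) (projector E2 y)"
    by (metis Int_commute)
  then show ?thesis
  proof cases
    case 1
    then show ?thesis
      by (rule violating_state_in_subspace[OF assms(1,2) projector_in[OF assms(1)]])
  next
    case 2
    then show ?thesis
      using violating_state_in_subspace[OF assms(2,1) projector_in[OF assms(2)]]
      by (simp add: Int_commute add.commute)
  qed
qed

end
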